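(* Let $m\ge0$, $G=\mathbb S^1$, let $H$ be the trivial subgroup, $h=1$, and $\lambda>\pi^2$. Then there is no $G$-invariant quasi-Einstein metric $(g,u)$ with constant $\lambda$ on $G/H\times(0,1)$, with $g=dt\otimes dt+g_t$ and $(g,u)$ smoothly extendable to $G/H\times[0,1]$, such that $u(0)=u(1)$.
   Context: For $m\ge0$, a pair $(g,u)$ of a Riemannian metric and a smooth function is a quasi-Einstein metric with constant $\lambda$ if $Ric(g)+Hess(u)-m\,du\otimes du=\lambda g$. It is $G$-invariant if both $g$ and $u$ are, so $u=u(t)$. The metrics considered have the form $g=h^2\,dt\otimes dt+g_t$ with $h>0$ constant, $t\in(0,1)$, and $g_t$ a smooth family of $G$-invariant metrics on $G/H=\mathbb S^1$. *)

theory Defs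
  imports "HOL-Analysis.Analysis"
begin

text \<open>
  The manifold \<open>S\<^sup>1 \<times> I\<close> is realised as a subset of \<open>complex \<times> real\<close>, with \<open>S\<^sup>1\<close> the unit circle.
  Tensor fields are functions of a base point and two ambient vectors; only their values on tangent
  vectors are meaningful. Smoothness and curvature are computed in the angular coordinates
  \<open>(\<theta>, t) \<mapsto> (cis \<theta>, t)\<close>; this map is a local diffeomorphism onto the cylinder whose local inverses
  are charts covering it, so conditions imposed at all \<open>(\<theta>, t)\<close> are conditions on the whole cylinder.
\<close>

section \<open>Smooth functions\<close>

primrec Ck_on :: "nat \<Rightarrow> 'a::euclidean_space set \<Rightarrow> ('a \<Rightarrow> real) \<Rightarrow> bool" where
  "Ck_on 0 U f = continuous_on U f"
| "Ck_on (Suc k) U f =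
     (f differentiable_on U \<and> (\<forall>v. Ck_on k U (\<lambda>x. frechet_derivative f (at x) v)))"

text \<open>\<open>Ck_on\<close> is meant for open sets. On an arbitrary set (here: domains with boundary), a function
  is smooth if near every point it is the restriction of a smooth function on an open set.\<close>

definition smooth_on :: "'a::euclidean_space set \<Rightarrow> ('a \<Rightarrow> real) \<Rightarrow> bool" where
  "smooth_on S f \<longleftrightarrow>
     (\<forall>x\<in>S. \<exists>U F. open U \<and> x \<in> U \<and> (\<forall>k. Ck_on k U F) \<and> (\<forall>y\<in>U \<inter> S. F y = f y))"


section \<open>Tensor fields of type (0,2)\<close>

type_synonym 'a tensor2 = "'a \<Rightarrow> 'a \<Rightarrow> 'a \<Rightarrow> real"

definition pullback ::
  "('a::real_normed_vector \<Rightarrow> 'b::real_normed_vector) \<Rightarrow> 'b tensor2 \<Rightarrow> 'a tensor2" where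
  "pullback \<phi> g = (\<lambda>x v w.
     g (\<phi> x) (frechet_derivative \<phi> (at x) v) (frechet_derivative \<phi> (at x) w))"

text \<open>\<open>g\<close> restricts to an inner product on every space \<open>T p\<close>, \<open>p \<in> M\<close>.\<close>

definition inner_products_on ::
  "'a::real_vector set \<Rightarrow> ('a \<Rightarrow> 'a set) \<Rightarrow> 'a tensor2 \<Rightarrow> bool" where
  "inner_products_on M T g \<longleftrightarrow> (\<forall>p\<in>M.
     (\<forall>v\<in>T p. \<forall>w\<in>T p. g p v w = g p w v) \<and>
     (\<forall>v\<in>T p. \<forall>v'\<in>T p. \<forall>w\<in>T p. g p (v + v') w = g p v w + g p v' w) \<and>
     (\<forall>c. \<forall>v\<in>T p. \<forall>w\<in>T p. g p (c *\<^sub>R v) w = c * g p v w) \<and>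
     (\<forall>v\<in>T p. v \<noteq> 0 \<longrightarrow> 0 < g p v v))"

definition tensor_eq_on ::
  "'a set \<Rightarrow> ('a \<Rightarrow> 'a set) \<Rightarrow> 'a tensor2 \<Rightarrow> 'a tensor2 \<Rightarrow> bool" where
  "tensor_eq_on M T g g' \<longleftrightarrow> (\<forall>p\<in>M. \<forall>v\<in>T p. \<forall>w\<in>T p. g p v w = g' p v w)"


section \<open>Ricci curvature and Hessian in local coordinates\<close>

definition partial :: "'n::finite \<Rightarrow> (real^'n \<Rightarrow> real) \<Rightarrow> real^'n \<Rightarrow> real" where
  "partial i f x = frechet_derivative f (at x) (axis i 1)"

definition components :: "(real^'n::finite) tensor2 \<Rightarrow> real^'n \<Rightarrow> real^'n^'n" where
  "components g x = (\<chi> i j. g x (axis i 1) (axis j 1))"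

text \<open>\<open>christoffel g k i j\<close> is the symbol with upper index \<open>k\<close> and lower indices \<open>i, j\<close>.\<close>

definition christoffel ::
  "(real^'n::finite) tensor2 \<Rightarrow> 'n \<Rightarrow> 'n \<Rightarrow> 'n \<Rightarrow> real^'n \<Rightarrow> real" where
  "christoffel g k i j x = (\<Sum>l\<in>UNIV. matrix_inv (components g x) $ k $ l *
     (partial i (\<lambda>y. components g y $ j $ l) x
      + partial j (\<lambda>y. components g y $ i $ l) x
      - partial l (\<lambda>y. components g y $ i $ j) x) / 2)"

text \<open>\<open>riemann g l i j k\<close> is the coefficient of \<open>\<partial>\<^sub>l\<close> in \<open>R(\<partial>\<^sub>i, \<partial>\<^sub>j) \<partial>\<^sub>k\<close>, where
  \<open>R(X, Y) Z = \<nabla>\<^sub>X \<nabla>\<^sub>Y Z - \<nabla>\<^sub>Y \<nabla>\<^sub>X Z - \<nabla>\<^bsub>[X, Y]\<^esub> Z\<close>; round spheres have positive Ricci curvature.\<close>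

definition riemann ::
  "(real^'n::finite) tensor2 \<Rightarrow> 'n \<Rightarrow> 'n \<Rightarrow> 'n \<Rightarrow> 'n \<Rightarrow> real^'n \<Rightarrow> real" where
  "riemann g l i j k x =
     partial i (christoffel g l j k) x - partial j (christoffel g l i k) x
     + (\<Sum>r\<in>UNIV. christoffel g l i r x * christoffel g r j k x
                 - christoffel g l j r x * christoffel g r i k x)"

definition ricci :: "(real^'n::finite) tensor2 \<Rightarrow> 'n \<Rightarrow> 'n \<Rightarrow> real^'n \<Rightarrow> real" where
  "ricci g j k x = (\<Sum>i\<in>UNIV. riemann g i i j k x)"

definition hess ::
  "(real^'n::finite) tensor2 \<Rightarrow> (real^'n \<Rightarrow> real) \<Rightarrow> 'n \<Rightarrow> 'n \<Rightarrow> real^'n \<Rightarrow> real" where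
  "hess g u i j x =
     partial i (partial j u) x - (\<Sum>k\<in>UNIV. christoffel g k i j x * partial k u x)"


section \<open>The circle and the cylinder\<close>

abbreviation circle :: "complex set" where
  "circle \<equiv> sphere 0 1"

definition circle_tangent :: "complex \<Rightarrow> complex set" where
  "circle_tangent z = {a. a \<bullet> z = 0}"

definition cylinder :: "real set \<Rightarrow> (complex \<times> real) set" where
  "cylinder I = circle \<times> I"

definition cyl_tangent :: "complex \<times> real \<Rightarrow> (complex \<times> real) set" where
  "cyl_tangent p = circle_tangent (fst p) \<times> UNIV"

text \<open>Index 1 is the angle, index 2 the coordinate \<open>t\<close>.\<close>

definition cyl_chart :: "real^2 \<Rightarrow> complex \<times> real" where
  "cyl_chart x = (cis (x $ 1), x $ 2)"

definition cyl_coords :: "real set \<Rightarrow> (real^2) set" where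
  "cyl_coords I = {x. x $ 2 \<in> I}"

definition cyl_smooth_fun :: "real set \<Rightarrow> (complex \<times> real \<Rightarrow> real) \<Rightarrow> bool" where
  "cyl_smooth_fun I u \<longleftrightarrow> smooth_on (cyl_coords I) (u \<circ> cyl_chart)"

definition cyl_riemannian_metric :: "real set \<Rightarrow> (complex \<times> real) tensor2 \<Rightarrow> bool" where
  "cyl_riemannian_metric I g \<longleftrightarrow>
     inner_products_on (cylinder I) cyl_tangent g \<and>
     (\<forall>i j. smooth_on (cyl_coords I) (\<lambda>x. components (pullback cyl_chart g) x $ i $ j))"

definition quasi_einstein ::
  "real \<Rightarrow> real \<Rightarrow> real set \<Rightarrow> (complex \<times> real) tensor2 \<Rightarrow> (complex \<times> real \<Rightarrow> real) \<Rightarrow> bool"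
  where
  "quasi_einstein m lam I g u \<longleftrightarrow>
     cyl_riemannian_metric I g \<and> cyl_smooth_fun I u \<and>
     (let gc = pullback cyl_chart g; uc = u \<circ> cyl_chart in
      \<forall>x\<in>cyl_coords I. \<forall>i j.
        ricci gc i j x + hess gc uc i j x - m * (partial i uc x * partial j uc x)
          = lam * components gc x $ i $ j)"

text \<open>Since \<open>H\<close> is trivial, \<open>G/H\<close> is \<open>G = S\<^sup>1\<close>, acted on by multiplication.\<close>

definition cyl_act :: "complex \<Rightarrow> complex \<times> real \<Rightarrow> complex \<times> real" where
  "cyl_act a p = (a * fst p, snd p)"

definition cyl_invariant ::
  "real set \<Rightarrow> (complex \<times> real) tensor2 \<Rightarrow> (complex \<times> real \<Rightarrow> real) \<Rightarrow> bool" where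
  "cyl_invariant I g u \<longleftrightarrow> (\<forall>a\<in>circle.
     tensor_eq_on (cylinder I) cyl_tangent (pullback (cyl_act a) g) g \<and>
     (\<forall>p\<in>cylinder I. u (cyl_act a p) = u p))"

text \<open>A smooth family, indexed by \<open>t \<in> I\<close>, of invariant metrics on the circle. The tangent spaces of
  the circle are spanned by the derivative of \<open>cis\<close>, so smoothness of the family, jointly in \<open>\<theta>\<close> and
  \<open>t\<close>, is smoothness of the single coefficient of \<open>d\<theta> \<otimes> d\<theta>\<close>.\<close>

definition invariant_circle_metrics :: "real set \<Rightarrow> (real \<Rightarrow> complex tensor2) \<Rightarrow> bool" where
  "invariant_circle_metrics I \<gamma> \<longleftrightarrow>
     (\<forall>t\<in>I. inner_products_on circle circle_tangent (\<gamma> t) \<and>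
       (\<forall>a\<in>circle. tensor_eq_on circle circle_tangent (pullback ((*) a) (\<gamma> t)) (\<gamma> t))) \<and>
     smooth_on (cyl_coords I) (\<lambda>x. pullback cis (\<gamma> (x $ 2)) (x $ 1) 1 1)"

text \<open>The metric \<open>h\<^sup>2 dt \<otimes> dt + \<gamma>\<^sub>t\<close>.\<close>

definition cohom1_metric :: "real \<Rightarrow> (real \<Rightarrow> complex tensor2) \<Rightarrow> (complex \<times> real) tensor2" where
  "cohom1_metric h \<gamma> p v w = h\<^sup>2 * (snd v * snd w) + \<gamma> (snd p) (fst p) (fst v) (fst w)"

text \<open>\<open>(g', u')\<close> is a smooth extension of \<open>(g, u)\<close> from \<open>S\<^sup>1 \<times> I\<close> to \<open>S\<^sup>1 \<times> J\<close>; the extended tensor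
  is again required to be a Riemannian metric.\<close>

definition smooth_extension ::
  "real set \<Rightarrow> real set \<Rightarrow> (complex \<times> real) tensor2 \<Rightarrow> (complex \<times> real \<Rightarrow> real)
     \<Rightarrow> (complex \<times> real) tensor2 \<Rightarrow> (complex \<times> real \<Rightarrow> real) \<Rightarrow> bool" where
  "smooth_extension I J g u g' u' \<longleftrightarrow>
     cyl_riemannian_metric J g' \<and> cyl_smooth_fun J u' \<and>
     tensor_eq_on (cylinder I) cyl_tangent g' g \<and> (\<forall>p\<in>cylinder I. u' p = u p)"

end

(* In the coordinates (theta, t) an invariant metric is dt^2 + f(t)^2 dtheta^2 and the quasi-Einstein
   equations become
     -f''/f + u'' - m u'^2 = lambda   and   -f''/f + f' u'/f = lambda.
   Their difference says that u' exp(-m u) / f is constant. As u(0) = u(1), Rolle's theorem makes the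
   constant zero, so u' = 0 and f'' = -lambda f. A positive solution of this equation cannot live on
   an interval longer than pi / sqrt lambda, which is less than 1. *)
theory Submission
  imports Defs
begin

section \<open>Smooth functions\<close>

text \<open>\<open>frechet_derivative F (at x)\<close> sees only the values of \<open>F\<close> near
  \<open>x\<close>. On an open set, agreement of two functions therefore passes to their derivatives
  of every order.\<close>

lemma Ck_on_cong:
  assumes "open V" "V \<subseteq> U" "\<And>y. y \<in> V \<Longrightarrow> F y = f y" "Ck_on k U F"
  shows "Ck_on k V f"
  using assms(3,4)
proof (induction k arbitrary: F f)
  case 0
  then show ?case
    using continuous_on_subset[OF _ assms(2), of F] continuous_on_cong[of V V F f] by simp
next
  case (Suc k)
  have diffF: "F differentiable_on V"
    using Suc.prems(2) assms(2) differentiable_on_subset by auto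
  have "f differentiable_on V"
    unfolding differentiable_on_def
  proof
    fix x assume x: "x \<in> V"
    then have "F differentiable (at x within V)"
      using diffF by (simp add: differentiable_on_def)
    then show "f differentiable (at x within V)"
      by (rule differentiable_transform_within[OF _ zero_less_one x]) (rule Suc.prems(1))
  qed
  moreover have "Ck_on k V (\<lambda>x. frechet_derivative f (at x) v)" for v
  proof (rule Suc.IH)
    show "Ck_on k U (\<lambda>x. frechet_derivative F (at x) v)"
      using Suc.prems(2) by simp
    show "frechet_derivative F (at y) v = frechet_derivative f (at y) v" if "y \<in> V" for y
      using frechet_derivative_transform_within_open[of F y V f] that diffF assms(1) Suc.prems(1)
      by (simp add: differentiable_on_eq_differentiable_at)
  qed
  ultimately show ?case by simp
qed

lemma Ck_on_local:
  assumes "\<And>x. x \<in> S \<Longrightarrow> \<exists>V. open V \<and> x \<in> V \<and> V \<subseteq> S \<and> Ck_on k V f"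
  shows "Ck_on k S f"
  using assms
proof (induction k arbitrary: f)
  case 0
  show ?case
    unfolding Ck_on.simps
  proof (rule continuous_at_imp_continuous_on, rule ballI)
    fix x assume "x \<in> S"
    then obtain V where "open V" "x \<in> V" "continuous_on V f"
      using 0[of x] by auto
    then show "isCont f x"
      by (simp add: continuous_on_eq_continuous_at)
  qed
next
  case (Suc k)
  have "f differentiable_on S"
    unfolding differentiable_on_def
  proof
    fix x assume "x \<in> S"
    then obtain V where "open V" "x \<in> V" "f differentiable_on V"
      using Suc.prems[of x] by auto
    then show "f differentiable (at x within S)"
      by (simp add: differentiable_at_withinI differentiable_on_eq_differentiable_at)
  qed
  moreover have "Ck_on k S (\<lambda>x. frechet_derivative f (at x) v)" for v
  proof (rule Suc.IH)
    fix x assume "x \<in> S"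
    then show "\<exists>V. open V \<and> x \<in> V \<and> V \<subseteq> S \<and> Ck_on k V (\<lambda>x. frechet_derivative f (at x) v)"
      using Suc.prems[of x] by auto
  qed
  ultimately show ?case by simp
qed

text \<open>On an open set a local extension has nothing to extend: on the open set
  \<open>U \<inter> S\<close> it equals \<open>f\<close>, so its derivatives are those of
  \<open>f\<close>. This lets the classical derivatives of \<open>f\<close> itself be used
  below.\<close>

lemma smooth_on_open_imp_Ck_on:
  assumes "open S" "smooth_on S f"
  shows "Ck_on k S f"
proof (rule Ck_on_local)
  fix x assume "x \<in> S"
  then obtain U F where UF: "open U" "x \<in> U" "Ck_on k U F" "\<And>y. y \<in> U \<inter> S \<Longrightarrow> F y = f y"
    using assms(2) unfolding smooth_on_def by meson
  then have "Ck_on k (U \<inter> S) f"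
    using assms(1) by (intro Ck_on_cong[of "U \<inter> S" U F]) auto
  then show "\<exists>V. open V \<and> x \<in> V \<and> V \<subseteq> S \<and> Ck_on k V f"
    using UF \<open>x \<in> S\<close> assms(1) by (intro exI[of _ "U \<inter> S"]) auto
qed

text \<open>Here \<open>S\<close> need not be open. The lemma serves for the extension to the closed
  cylinder, where continuity up to the boundary is what Rolle's theorem asks for.\<close>

lemma smooth_on_imp_continuous_on:
  assumes "smooth_on S f"
  shows "continuous_on S f"
  unfolding continuous_on_eq_continuous_within
proof
  fix x assume "x \<in> S"
  then obtain U F where UF: "open U" "x \<in> U" "Ck_on 0 U F" "\<And>y. y \<in> U \<inter> S \<Longrightarrow> F y = f y"
    using assms unfolding smooth_on_def by meson
  then have "continuous_on (U \<inter> S) f"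
    using continuous_on_subset[of U F "U \<inter> S"] continuous_on_cong[of "U \<inter> S" "U \<inter> S" F f] by simp
  then have "continuous (at x within U \<inter> S) f"
    using UF(2) \<open>x \<in> S\<close> by (simp add: continuous_on_eq_continuous_within)
  moreover have "at x within U \<inter> S = at x within S"
    by (rule at_within_nhd[OF UF(2,1)]) auto
  ultimately show "continuous (at x within S) f" by simp
qed

section \<open>Derivatives along a coordinate axis\<close>

lemma has_derivative_axis:
  fixes i :: "'n::finite" and t :: real
  shows "(axis i has_derivative axis i) (at t)"
proof -
  have "(axis i :: real \<Rightarrow> real^'n) = (\<lambda>s. s *\<^sub>R axis i 1)"
    by (auto simp: axis_def vec_eq_iff)
  then show ?thesis
    using bounded_linear_imp_has_derivative[OF bounded_linear_scaleR_left] by metis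
qed

text \<open>\<open>axis i\<close> parametrises the \<open>i\<close>-th coordinate line through the
  origin with velocity \<open>axis i 1\<close>, so the chain rule turns a partial derivative into an
  ordinary one.\<close>

lemma has_real_derivative_along_axis:
  fixes f :: "real^'n::finite \<Rightarrow> real"
  assumes "f differentiable (at (axis i t))"
  shows "((\<lambda>s. f (axis i s)) has_real_derivative partial i f (axis i t)) (at t)"
proof -
  let ?D = "frechet_derivative f (at (axis i t))"
  have D: "(f has_derivative ?D) (at (axis i t))"
    using assms frechet_derivative_works by blast
  then have "((\<lambda>s. f (axis i s)) has_derivative (\<lambda>s. ?D (axis i s))) (at t)"
    using has_derivative_compose[OF has_derivative_axis] by blast
  moreover have "?D (axis i s) = partial i f (axis i t) * s" for s
  proof -
    have "axis i s = s *\<^sub>R (axis i 1 :: real^'n)"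
      by (auto simp: axis_def vec_eq_iff)
    then show ?thesis
      using linear_scale[OF has_derivative_linear[OF D]] by (simp add: partial_def)
  qed
  ultimately show ?thesis
    by (simp add: has_field_derivative_def)
qed

lemma smooth_on_has_two_derivatives_along_axis:
  fixes f :: "real^'n::finite \<Rightarrow> real"
  assumes "open S" "smooth_on S f" "axis i t \<in> S"
  shows "((\<lambda>s. f (axis i s)) has_real_derivative partial i f (axis i t)) (at t)"
    and "((\<lambda>s. partial i f (axis i s)) has_real_derivative
          partial i (partial i f) (axis i t)) (at t)"
proof -
  have C2: "Ck_on (Suc (Suc 0)) S f"
    using smooth_on_open_imp_Ck_on assms by blast
  then have "f differentiable (at (axis i t))" "partial i f differentiable (at (axis i t))"
    using assms(1,3) unfolding partial_def
    by (auto simp: differentiable_on_eq_differentiable_at)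
  then show "((\<lambda>s. f (axis i s)) has_real_derivative partial i f (axis i t)) (at t)"
    and "((\<lambda>s. partial i f (axis i s)) has_real_derivative
          partial i (partial i f) (axis i t)) (at t)"
    by (simp_all add: has_real_derivative_along_axis)
qed

section \<open>Curvature of a metric depending on one coordinate\<close>

lemma open_cyl_coords: "open I \<Longrightarrow> open (cyl_coords I)"
  unfolding cyl_coords_def
  using open_vimage[of I "\<lambda>x::real^2. x $ 2"] by (simp add: vimage_def continuous_on_component)

lemma partial_cyl_coords:
  assumes "open I" "x \<in> cyl_coords I" "\<And>y. y \<in> cyl_coords I \<Longrightarrow> h y = p (y $ 2)"
    "(p has_real_derivative d) (at (x $ 2))"
  shows "partial i h x = (if i = 2 then d else 0)"
proof -
  have "((\<lambda>y::real^2. p (y $ 2)) has_derivative (\<lambda>v. d * v $ 2)) (at x)"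
    using has_derivative_compose[OF bounded_linear_imp_has_derivative[OF bounded_linear_vec_nth]]
      assms(4) unfolding has_field_derivative_def by blast
  then have "(h has_derivative (\<lambda>v. d * v $ 2)) (at x)"
    using has_derivative_transform_within_open[OF _ open_cyl_coords[OF assms(1)] assms(2)] assms(3)
    by metis
  then have "frechet_derivative h (at x) = (\<lambda>v. d * v $ 2)"
    by (rule frechet_derivative_at[symmetric])
  then show ?thesis
    by (auto simp: partial_def axis_def)
qed

text \<open>\<open>matrix_inv\<close> is a choice of two-sided inverse. For square matrices a right
  inverse is also a left inverse, and associativity makes it unique.\<close>

lemma matrix_inv_eqI:
  fixes A B :: "real^'n::finite^'n"
  assumes "A ** B = mat 1"
  shows "matrix_inv A = B"
proof -
  have BA: "B ** A = mat 1" using assms matrix_left_right_inverse by blast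
  then have "matrix_inv A ** A = mat 1"
    unfolding matrix_inv_def using assms by (rule someI2[of _ B, OF conjI[rotated], THEN conjunct2]) auto
  then show ?thesis using assms by (metis matrix_mul_assoc matrix_mul_lid matrix_mul_rid)
qed

definition diag2 :: "real \<Rightarrow> real \<Rightarrow> real^2^2" where
  "diag2 a b = (\<chi> i j. if i = j then (if i = 1 then a else b) else 0)"

lemma diag2_nth [simp]:
  "diag2 a b $ 1 $ 1 = a" "diag2 a b $ 2 $ 2 = b" "diag2 a b $ 1 $ 2 = 0" "diag2 a b $ 2 $ 1 = 0"
  by (simp_all add: diag2_def)

lemma matrix_inv_diag2: "a \<noteq> 0 \<Longrightarrow> matrix_inv (diag2 a 1) = diag2 (1 / a) 1"
  by (rule matrix_inv_eqI)
    (simp add: vec_eq_iff forall_2 matrix_matrix_mult_def sum_2 mat_def)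

text \<open>The metric G(t) dtheta^2 + dt^2. The derivatives of \<open>G\<close> are parameters, so
  that curvature becomes an algebraic expression in \<open>G\<close>, \<open>G1\<close>,
  \<open>G2\<close>; \<open>G\<close> is a metric component and is differentiated without first
  taking a square root.\<close>

locale warped_metric =
  fixes g :: "(real^2) tensor2" and I :: "real set" and G G1 G2 :: "real \<Rightarrow> real"
  assumes open_I: "open I"
    and components: "\<And>x. x \<in> cyl_coords I \<Longrightarrow> components g x = diag2 (G (x $ 2)) 1"
    and pos: "\<And>t. t \<in> I \<Longrightarrow> G t > 0"
    and deriv1: "\<And>t. t \<in> I \<Longrightarrow> (G has_real_derivative G1 t) (at t)"
    and deriv2: "\<And>t. t \<in> I \<Longrightarrow> (G1 has_real_derivative G2 t) (at t)"
begin

lemma partial_components: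
  assumes "x \<in> cyl_coords I"
  shows "partial i (\<lambda>y. components g y $ j $ k) x = (if i = 2 \<and> j = 1 \<and> k = 1 then G1 (x $ 2) else 0)"
proof -
  have "x $ 2 \<in> I" using assms by (simp add: cyl_coords_def)
  then have "((\<lambda>t. diag2 (G t) 1 $ j $ k) has_real_derivative
      (if j = 1 \<and> k = 1 then G1 (x $ 2) else 0)) (at (x $ 2))"
    using deriv1 exhaust_2[of j] exhaust_2[of k] by auto
  then show ?thesis
    using partial_cyl_coords[OF open_I assms, of "\<lambda>y. components g y $ j $ k"
        "\<lambda>t. diag2 (G t) 1 $ j $ k"] components by simp
qed

text \<open>The only nonzero first derivative of a component is that of the theta-theta component in
  direction t, which leaves the three symbols with two indices 1 and one index 2.\<close>

lemma christoffel_eq: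
  assumes "x \<in> cyl_coords I"
  shows "christoffel g 1 1 1 x = 0" "christoffel g 1 2 2 x = 0"
    "christoffel g 1 1 2 x = G1 (x $ 2) / (2 * G (x $ 2))"
    "christoffel g 1 2 1 x = G1 (x $ 2) / (2 * G (x $ 2))"
    "christoffel g 2 1 1 x = - G1 (x $ 2) / 2"
    "christoffel g 2 1 2 x = 0" "christoffel g 2 2 1 x = 0" "christoffel g 2 2 2 x = 0"
proof -
  have "G (x $ 2) \<noteq> 0"
    using pos[of "x $ 2"] assms by (simp add: cyl_coords_def)
  then have inv: "matrix_inv (components g x) = diag2 (1 / G (x $ 2)) 1"
    using components[OF assms] matrix_inv_diag2 by simp
  show "christoffel g 1 1 1 x = 0" "christoffel g 1 2 2 x = 0"
    "christoffel g 1 1 2 x = G1 (x $ 2) / (2 * G (x $ 2))"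
    "christoffel g 1 2 1 x = G1 (x $ 2) / (2 * G (x $ 2))"
    "christoffel g 2 1 1 x = - G1 (x $ 2) / 2"
    "christoffel g 2 1 2 x = 0" "christoffel g 2 2 1 x = 0" "christoffel g 2 2 2 x = 0"
    by (simp_all add: christoffel_def inv sum_2 partial_components[OF assms])
qed

lemma partial_christoffel:
  assumes "x \<in> cyl_coords I"
  shows "partial 1 (christoffel g k i j) x = 0"
    "partial 2 (christoffel g 1 2 2) x = 0"
    "partial 2 (christoffel g 2 1 1) x = - G2 (x $ 2) / 2"
    "partial 2 (christoffel g 2 1 2) x = 0"
    "partial 2 (christoffel g 2 2 1) x = 0"
    "partial 2 (christoffel g 1 1 2) x =
      G2 (x $ 2) / (2 * G (x $ 2)) - (G1 (x $ 2))\<^sup>2 / (2 * (G (x $ 2))\<^sup>2)"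
proof -
  let ?t = "x $ 2"
  have t: "?t \<in> I" using assms by (simp add: cyl_coords_def)
  note part = partial_cyl_coords[OF open_I assms]
  have D0: "((\<lambda>t. 0) has_real_derivative 0) (at ?t)" by simp
  have D1: "((\<lambda>t. - G1 t / 2) has_real_derivative - G2 ?t / 2) (at ?t)"
    using deriv2[OF t] by (auto intro!: derivative_eq_intros)
  have D2: "((\<lambda>t. G1 t / (2 * G t)) has_real_derivative
      G2 ?t / (2 * G ?t) - (G1 ?t)\<^sup>2 / (2 * (G ?t)\<^sup>2)) (at ?t)"
    using deriv1[OF t] deriv2[OF t] pos[OF t]
    by (auto intro!: derivative_eq_intros simp: field_simps power2_eq_square)
  \<comment> \<open>For each of the eight index triples the symbol is one of the three functions of
    t alone in \<open>D0\<close>, \<open>D1\<close>, \<open>D2\<close>, hence constant in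
    theta.\<close>
  show "partial 1 (christoffel g k i j) x = 0"
    using exhaust_2[of k] exhaust_2[of i] exhaust_2[of j]
      part[OF _ D0] part[OF _ D1] part[OF _ D2] christoffel_eq by fastforce
  show "partial 2 (christoffel g 1 2 2) x = 0" "partial 2 (christoffel g 2 1 2) x = 0"
    "partial 2 (christoffel g 2 2 1) x = 0"
    by (simp_all add: part[OF _ D0] christoffel_eq)
  show "partial 2 (christoffel g 2 1 1) x = - G2 ?t / 2"
    by (simp add: part[OF _ D1] christoffel_eq)
  show "partial 2 (christoffel g 1 1 2) x = G2 ?t / (2 * G ?t) - (G1 ?t)\<^sup>2 / (2 * (G ?t)\<^sup>2)"
    by (simp add: part[OF _ D2] christoffel_eq)
qed

text \<open>In dimension two Ric is the Gaussian curvature times the metric. With f = sqrt G that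
  curvature is -f''/f, which is the t-t entry; the theta-theta entry is \<open>G\<close> times
  it.\<close>

lemma ricci_eq:
  assumes "x \<in> cyl_coords I"
  shows "ricci g 1 1 x = - G2 (x $ 2) / 2 + (G1 (x $ 2))\<^sup>2 / (4 * G (x $ 2))"
    "ricci g 2 2 x = - G2 (x $ 2) / (2 * G (x $ 2)) + (G1 (x $ 2))\<^sup>2 / (4 * (G (x $ 2))\<^sup>2)"
  by (simp_all add: ricci_def riemann_def sum_2 christoffel_eq[OF assms]
      partial_christoffel[OF assms] power2_eq_square)

text \<open>The theta-theta entry comes only from the symbol with upper index 2 and lower indices 1,
  1, as \<open>u\<close> does not vary with theta. The t-lines are geodesics, so the t-t entry is a
  plain second derivative.\<close>

lemma hess_eq:
  assumes "x \<in> cyl_coords I" "\<And>y. y \<in> cyl_coords I \<Longrightarrow> u y = q (y $ 2)"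
    and q1: "\<And>t. t \<in> I \<Longrightarrow> (q has_real_derivative q1 t) (at t)"
    and q2: "\<And>t. t \<in> I \<Longrightarrow> (q1 has_real_derivative q2 t) (at t)"
  shows "partial 2 u x = q1 (x $ 2)" "partial 1 u x = 0"
    "hess g u 1 1 x = G1 (x $ 2) * q1 (x $ 2) / 2"
    "hess g u 2 2 x = q2 (x $ 2)"
proof -
  have part: "partial 2 u y = q1 (y $ 2)" "partial 1 u y = 0" if "y \<in> cyl_coords I" for y
    using partial_cyl_coords[where p = q, OF open_I that assms(2)] q1[of "y $ 2"] that
    by (auto simp: cyl_coords_def)
  have "x $ 2 \<in> I" using assms(1) by (simp add: cyl_coords_def)
  then have "partial 2 (partial 2 u) x = q2 (x $ 2)" "partial 1 (partial 1 u) x = 0"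
    using partial_cyl_coords[where p = q1, OF open_I assms(1) part(1)] q2[of "x $ 2"]
      partial_cyl_coords[where p = "\<lambda>_. 0" and d = 0 and i = 1, OF open_I assms(1) part(2)]
    by simp_all
  then show "partial 2 u x = q1 (x $ 2)" "partial 1 u x = 0"
    "hess g u 1 1 x = G1 (x $ 2) * q1 (x $ 2) / 2"
    "hess g u 2 2 x = q2 (x $ 2)"
    by (simp_all add: hess_def sum_2 christoffel_eq[OF assms(1)] part[OF assms(1)])
qed

end

section \<open>The ordinary differential equations\<close>

lemma DERIV_zero_const_on_interval:
  fixes f :: "real \<Rightarrow> real"
  assumes "\<And>t. t \<in> {a<..<b} \<Longrightarrow> (f has_real_derivative 0) (at t)" "s \<in> {a<..<b}" "t \<in> {a<..<b}"
  shows "f s = f t"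
proof -
  obtain c where "\<And>x. x \<in> {a<..<b} \<Longrightarrow> f x = c"
    using has_field_derivative_zero_constant[of "{a<..<b}" f] assms(1)
      has_field_derivative_at_within convex_real_interval(8) by blast
  then show ?thesis using assms(2,3) by simp
qed

lemma sturm_no_positive_solution:
  fixes f f1 :: "real \<Rightarrow> real"
  assumes "b - a > pi / k" "k > 0"
    and pos: "\<And>t. t \<in> {a<..<b} \<Longrightarrow> f t > 0"
    and d1: "\<And>t. t \<in> {a<..<b} \<Longrightarrow> (f has_real_derivative f1 t) (at t)"
    and d2: "\<And>t. t \<in> {a<..<b} \<Longrightarrow> (f1 has_real_derivative - k\<^sup>2 * f t) (at t)"
  shows False
proof -
  \<comment> \<open>The slack \<open>b - a - pi / k\<close> is split evenly, so both
    \<open>c\<close> and \<open>d\<close> are interior points; the equation is known only on the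
    open interval.\<close>
  define c where "c = a + (b - a - pi / k) / 2"
  define d where "d = c + pi / k"
  have "pi / k > 0" using assms(2) by simp
  then have cd: "c \<in> {a<..<b}" "d \<in> {a<..<b}"
    using assms(1) by (auto simp: c_def d_def field_simps)
  \<comment> \<open>The Wronskian of \<open>f\<close> and the sine that vanishes at \<open>c\<close> and at \<open>d\<close>, both inside the interval.\<close>
  define W where "W t = f1 t * sin (k * (t - c)) - f t * (k * cos (k * (t - c)))" for t
  have "(W has_real_derivative 0) (at t)" if "t \<in> {a<..<b}" for t
    unfolding W_def using d1[OF that] d2[OF that]
    by (auto intro!: derivative_eq_intros simp: algebra_simps power2_eq_square)
  then have "W c = W d"
    using DERIV_zero_const_on_interval[of a b W] cd by blast
  \<comment> \<open>The sine terms vanish at both points, while the cosine is 1 at \<open>c\<close>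
    and -1 at \<open>d\<close>.\<close>
  then have "- (f c * k) = f d * k"
    using assms(2) by (simp add: W_def d_def)
  moreover have "f c * k > 0" "f d * k > 0"
    using pos cd assms(2) by auto
  ultimately show False by linarith
qed

text \<open>Where \<open>q1\<close> is nonzero, \<open>eq\<close> reads (log |q1|)' = m q' + (log
  f)'. This suggests the first integral \<open>w\<close>, which is defined also at zeros of
  \<open>q1\<close>; one zero of \<open>q1\<close> then forces all values to vanish.\<close>

lemma quasi_einstein_ode_derivative_zero:
  fixes f f1 q q1 q2 :: "real \<Rightarrow> real"
  assumes "a < b" "continuous_on {a..b} q" "q a = q b"
    and pos: "\<And>t. t \<in> {a<..<b} \<Longrightarrow> f t > 0"
    and f1: "\<And>t. t \<in> {a<..<b} \<Longrightarrow> (f has_real_derivative f1 t) (at t)"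
    and q1: "\<And>t. t \<in> {a<..<b} \<Longrightarrow> (q has_real_derivative q1 t) (at t)"
    and q2: "\<And>t. t \<in> {a<..<b} \<Longrightarrow> (q1 has_real_derivative q2 t) (at t)"
    and eq: "\<And>t. t \<in> {a<..<b} \<Longrightarrow> q2 t - m * (q1 t)\<^sup>2 = f1 t / f t * q1 t"
    and t: "t \<in> {a<..<b}"
  shows "q1 t = 0"
proof -
  obtain z where z: "a < z" "z < b" "(q has_real_derivative 0) (at z)"
    using Rolle[OF assms(1,3,2)] q1 real_differentiable_def by (metis greaterThanLessThan_iff)
  then have z0: "q1 z = 0"
    using q1[of z] DERIV_unique by auto
  define w where "w s = q1 s * exp (- m * q s) / f s" for s
  have "(w has_real_derivative 0) (at s)" if s: "s \<in> {a<..<b}" for s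
  proof -
    \<comment> \<open>Cleared of denominators and multiplied by the exponential, this is the
      vanishing of the numerator in the quotient rule for \<open>w\<close>.\<close>
    have "q2 s * f s = f1 s * q1 s + m * (q1 s)\<^sup>2 * f s"
      using eq[OF s] pos[OF s] by (simp add: field_simps)
    then have "q2 s * f s * exp (- m * q s) = (f1 s * q1 s + m * (q1 s)\<^sup>2 * f s) * exp (- m * q s)"
      by simp
    then show ?thesis
      unfolding w_def using f1[OF s] q1[OF s] q2[OF s] pos[OF s]
      by (auto intro!: derivative_eq_intros simp: algebra_simps power2_eq_square)
  qed
  then have "w t = w z"
    by (rule DERIV_zero_const_on_interval) (use z t in simp_all)
  then show ?thesis
    using z0 pos[OF t] by (simp add: w_def)
qed

section \<open>Invariant metrics on the cylinder\<close>

lemma cyl_chart_has_derivative: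
  "(cyl_chart has_derivative (\<lambda>v. (of_real (v $ 1) * (\<i> * cis (x $ 1)), v $ 2))) (at x)"
proof -
  have cis: "(cis has_derivative (\<lambda>s. of_real s * (\<i> * cis t))) (at t)" for t
    using has_derivative_cis[OF has_derivative_ident]
    by (simp add: scaleR_conv_of_real mult.assoc)
  show ?thesis
    unfolding cyl_chart_def[abs_def]
    by (intro has_derivative_Pair
        has_derivative_compose[OF bounded_linear_imp_has_derivative[OF bounded_linear_vec_nth] cis]
        bounded_linear_imp_has_derivative[OF bounded_linear_vec_nth])
qed

text \<open>Rotation by \<open>cis \<theta>\<close> is linear, hence its own derivative, and carries
  the base point 1 with tangent vector \<open>\<i>\<close> to \<open>cis \<theta>\<close> with
  tangent vector \<open>\<i> * cis \<theta>\<close>.\<close>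

lemma invariant_circle_tensor:
  assumes "\<And>a. a \<in> circle \<Longrightarrow> tensor_eq_on circle circle_tangent (pullback ((*) a) \<sigma>) \<sigma>"
  shows "\<sigma> (cis \<theta>) (\<i> * cis \<theta>) (\<i> * cis \<theta>) = \<sigma> 1 \<i> \<i>"
proof -
  have "frechet_derivative ((*) (cis \<theta>)) (at 1) = (*) (cis \<theta>)"
    using bounded_linear_imp_has_derivative[OF bounded_linear_mult_right]
    by (rule frechet_derivative_at[symmetric])
  then show ?thesis
    using assms[of "cis \<theta>"] unfolding tensor_eq_on_def
    by (auto simp: pullback_def circle_tangent_def mult.commute
        dest!: bspec[where x = 1] dest: bspec[where x = \<i>])
qed

text \<open>The chart sends the theta-direction to \<open>\<i> * cis \<theta>\<close> in the circle
  factor and the t-direction to the unit vector of the real factor. \<open>cohom1_metric\<close> has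
  no cross terms, and invariance removes theta from the remaining coefficient.\<close>

lemma components_cohom1:
  assumes \<gamma>: "invariant_circle_metrics I \<gamma>"
    and eq: "tensor_eq_on (cylinder I) cyl_tangent g (cohom1_metric 1 \<gamma>)"
    and x: "x \<in> cyl_coords I"
  shows "components (pullback cyl_chart g) x = diag2 (\<gamma> (x $ 2) 1 \<i> \<i>) 1"
    and "\<gamma> (x $ 2) 1 \<i> \<i> > 0"
proof -
  let ?z = "cis (x $ 1)" and ?\<sigma> = "\<gamma> (x $ 2)"
  have t: "x $ 2 \<in> I" using x by (simp add: cyl_coords_def)
  have inn: "inner_products_on circle circle_tangent ?\<sigma>"
    using \<gamma> t by (auto simp: invariant_circle_metrics_def)
  have tan: "of_real c * (\<i> * ?z) \<in> circle_tangent ?z" for c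
    by (simp add: circle_tangent_def inner_complex_def)
  have z: "?z \<in> circle" by simp
  have scale: "?\<sigma> ?z (c *\<^sub>R v) w = c * ?\<sigma> ?z v w"
    if "v \<in> circle_tangent ?z" "w \<in> circle_tangent ?z" for c v w
    using inn z that by (auto simp: inner_products_on_def)
  have tan1: "\<i> * ?z \<in> circle_tangent ?z" and tan0: "0 \<in> circle_tangent ?z"
    using tan[of 1] tan[of 0] by simp_all
  \<comment> \<open>The tensor is bilinear only on tangent vectors, so tangency is carried along:
    scaling by 0 treats the first slot, symmetry the second.\<close>
  have zero: "?\<sigma> ?z 0 w = 0" "?\<sigma> ?z w 0 = 0" if "w \<in> circle_tangent ?z" for w
  proof -
    show "?\<sigma> ?z 0 w = 0" using scale[OF tan0 that, of 0] by simp
    then show "?\<sigma> ?z w 0 = 0" using inn z that tan0 by (auto simp: inner_products_on_def)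
  qed
  have rot: "?\<sigma> ?z (\<i> * ?z) (\<i> * ?z) = ?\<sigma> 1 \<i> \<i>"
    using \<gamma> t by (intro invariant_circle_tensor) (auto simp: invariant_circle_metrics_def)
  have "pullback cyl_chart g x v w = v $ 2 * w $ 2 +
      ?\<sigma> ?z (of_real (v $ 1) * (\<i> * ?z)) (of_real (w $ 1) * (\<i> * ?z))" for v w
  proof -
    have "cyl_chart x \<in> cylinder I"
      using t by (simp add: cyl_chart_def cylinder_def)
    moreover have "(of_real (v $ 1) * (\<i> * ?z), v $ 2) \<in> cyl_tangent (cyl_chart x)" for v
      using tan by (simp add: cyl_tangent_def cyl_chart_def)
    ultimately have "g (cyl_chart x) (of_real (v $ 1) * (\<i> * ?z), v $ 2) (of_real (w $ 1) * (\<i> * ?z), w $ 2)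
      = cohom1_metric 1 \<gamma> (cyl_chart x) (of_real (v $ 1) * (\<i> * ?z), v $ 2) (of_real (w $ 1) * (\<i> * ?z), w $ 2)"
      using eq unfolding tensor_eq_on_def by blast
    then show ?thesis
      unfolding pullback_def frechet_derivative_at[OF cyl_chart_has_derivative, symmetric]
      by (simp add: cohom1_metric_def cyl_chart_def)
  qed
  then show "components (pullback cyl_chart g) x = diag2 (?\<sigma> 1 \<i> \<i>) 1"
    by (simp add: components_def vec_eq_iff forall_2 axis_def zero tan1 tan0 rot)
  have "?\<sigma> ?z (\<i> * ?z) (\<i> * ?z) > 0"
    using inn z tan1 by (auto simp: inner_products_on_def)
  then show "?\<sigma> 1 \<i> \<i> > 0" using rot by simp
qed

theorem proposition5p1:
  fixes m lam :: real
  assumes "m \<ge> 0" and "lam > pi\<^sup>2"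
  shows "\<not> (\<exists>g u \<gamma> g' u'.
    quasi_einstein m lam {0<..<1} g u \<and>
    cyl_invariant {0<..<1} g u \<and>
    invariant_circle_metrics {0<..<1} \<gamma> \<and>
    tensor_eq_on (cylinder {0<..<1}) cyl_tangent g (cohom1_metric 1 \<gamma>) \<and>
    smooth_extension {0<..<1} {0..1} g u g' u' \<and>
    (\<forall>z\<in>circle. u' (z, 0) = u' (z, 1)))"
proof (rule notI, elim exE conjE)
  fix g u \<gamma> g' u'
  let ?I = "{0<..<1::real}"
  assume qe: "quasi_einstein m lam ?I g u"
    and inv: "cyl_invariant ?I g u"
    and \<gamma>: "invariant_circle_metrics ?I \<gamma>"
    and eq: "tensor_eq_on (cylinder ?I) cyl_tangent g (cohom1_metric 1 \<gamma>)"
    and ext: "smooth_extension ?I {0..1} g u g' u'"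
    and ends: "\<forall>z\<in>circle. u' (z, 0) = u' (z, 1)"
  define gc where "gc = pullback cyl_chart g"
  define uc where "uc = u \<circ> cyl_chart"
  define E where "E x = components gc x $ 1 $ 1" for x
  have axis_coords: "axis 2 t \<in> cyl_coords ?I" if "t \<in> ?I" for t
    using that by (simp add: cyl_coords_def axis_def)
  have open_S: "open (cyl_coords ?I)"
    by (rule open_cyl_coords) simp
  have smooth_E: "smooth_on (cyl_coords ?I) E" and smooth_u: "smooth_on (cyl_coords ?I) uc"
    and field_eq: "\<And>x i j. x \<in> cyl_coords ?I \<Longrightarrow> ricci gc i j x + hess gc uc i j x
        - m * (partial i uc x * partial j uc x) = lam * components gc x $ i $ j"
    using qe unfolding quasi_einstein_def cyl_riemannian_metric_def cyl_smooth_fun_def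
    by (auto simp: gc_def uc_def E_def[abs_def] Let_def)

  \<comment> \<open>\<open>axis 2 t\<close> is the point theta = 0 at height t. Data are read off on
    this line and spread to all theta by invariance.\<close>
  define G where "G t = E (axis 2 t)" for t
  define G1 where "G1 t = partial 2 E (axis 2 t)" for t
  define G2 where "G2 t = partial 2 (partial 2 E) (axis 2 t)" for t
  have G: "G t = \<gamma> t 1 \<i> \<i>" "G t > 0" if "t \<in> ?I" for t
    using components_cohom1[OF \<gamma> eq axis_coords[OF that]]
    by (simp_all add: G_def E_def gc_def axis_def)
  interpret warped_metric gc ?I G G1 G2
  proof
    show "components gc x = diag2 (G (x $ 2)) 1" if "x \<in> cyl_coords ?I" for x
      using components_cohom1(1)[OF \<gamma> eq that] G(1)[of "x $ 2"] that
      by (simp add: gc_def cyl_coords_def)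
    show "(G has_real_derivative G1 t) (at t)" "(G1 has_real_derivative G2 t) (at t)" if "t \<in> ?I" for t
      using smooth_on_has_two_derivatives_along_axis[OF open_S smooth_E axis_coords[OF that]]
      by (simp_all add: G_def[abs_def] G1_def[abs_def] G2_def)
  qed (use G(2) in simp_all)

  \<comment> \<open>Taking the extension \<open>u'\<close> instead of \<open>u\<close> gives
    \<open>q\<close> meaningful values at 0 and 1; inside the interval the two agree.\<close>
  define q where "q t = u' (1, t)" for t
  define q1 where "q1 t = partial 2 uc (axis 2 t)" for t
  define q2 where "q2 t = partial 2 (partial 2 uc) (axis 2 t)" for t
  have uc: "uc x = q (x $ 2)" if "x \<in> cyl_coords ?I" for x
  proof -
    have I: "x $ 2 \<in> ?I" using that by (simp add: cyl_coords_def)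
    then have p: "(1, x $ 2) \<in> cylinder ?I" by (simp add: cylinder_def)
    then have "u (cyl_act (cis (x $ 1)) (1, x $ 2)) = u (1, x $ 2)"
      using inv unfolding cyl_invariant_def by simp
    moreover have "u' (1, x $ 2) = u (1, x $ 2)"
      using ext p unfolding smooth_extension_def by blast
    ultimately show ?thesis
      by (simp add: uc_def cyl_chart_def cyl_act_def q_def)
  qed
  have q1: "(q has_real_derivative q1 t) (at t)" and q2: "(q1 has_real_derivative q2 t) (at t)"
    if t: "t \<in> ?I" for t
  proof -
    note D = smooth_on_has_two_derivatives_along_axis[OF open_S smooth_u axis_coords[OF t]]
    show "(q1 has_real_derivative q2 t) (at t)"
      using D(2) by (simp add: q1_def[abs_def] q2_def)
    have "uc (axis 2 s) = q s" if "s \<in> ?I" for s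
      using uc[OF axis_coords[OF that]] by (simp add: axis_def)
    then show "(q has_real_derivative q1 t) (at t)"
      using has_field_derivative_transform_within_open[OF D(1) _ t, of q] by (simp add: q1_def)
  qed
  have cont_q: "continuous_on {0..1} q"
  proof -
    have "continuous_on (cyl_coords {0..1}) (u' \<circ> cyl_chart)"
      using ext smooth_on_imp_continuous_on
      unfolding smooth_extension_def cyl_smooth_fun_def by blast
    moreover have "continuous_on {0..1} (axis 2 :: real \<Rightarrow> real^2)"
      using has_derivative_continuous[OF has_derivative_axis] continuous_at_imp_continuous_on by blast
    moreover have "axis 2 ` {0..1} \<subseteq> cyl_coords {0..1}"
      by (auto simp: cyl_coords_def axis_def)
    ultimately have "continuous_on {0..1} ((u' \<circ> cyl_chart) \<circ> axis 2)"
      using continuous_on_compose continuous_on_subset by blast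
    moreover have "(u' \<circ> cyl_chart) \<circ> axis 2 = q"
      by (auto simp: q_def cyl_chart_def axis_def)
    ultimately show ?thesis by simp
  qed

  \<comment> \<open>\<open>f\<close> is the radius of the circle at height t, and \<open>K\<close>
    is f''/f, the negative of the Gaussian curvature.\<close>
  define f where "f t = sqrt (G t)" for t
  define f1 where "f1 t = G1 t / (2 * sqrt (G t))" for t
  define K where "K t = G2 t / (2 * G t) - (G1 t)\<^sup>2 / (4 * (G t)\<^sup>2)" for t
  have f_pos: "f t > 0" if "t \<in> ?I" for t
    using G(2)[OF that] by (simp add: f_def)
  have f1: "(f has_real_derivative f1 t) (at t)" if "t \<in> ?I" for t
    unfolding f_def f1_def using deriv1[OF that] G(2)[OF that]
    by (auto intro!: derivative_eq_intros simp: field_simps)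
  have f2: "(f1 has_real_derivative K t * f t) (at t)" if "t \<in> ?I" for t
  proof -
    \<comment> \<open>Writing G = r^2 turns the derivative identity into a rational one in
      r.\<close>
    have "(sqrt (G t))\<^sup>2 = G t" "sqrt (G t) > 0" using G(2)[OF that] by simp_all
    then obtain r where r: "sqrt (G t) = r" "G t = r\<^sup>2" "r > 0" by metis
    show ?thesis
      unfolding f1_def using deriv1[OF that] deriv2[OF that] G(2)[OF that] r(3)
      by (auto intro!: derivative_eq_intros simp: f_def K_def r(1))
        (simp add: r(2) field_simps power2_eq_square)
  qed
  have P: "f1 t / f t = G1 t / (2 * G t)" if "t \<in> ?I" for t
    using G(2)[OF that] by (simp add: f1_def f_def)
  have eq_tt: "- K t + q2 t - m * (q1 t)\<^sup>2 = lam"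
    and eq_\<theta>\<theta>: "- K t + f1 t / f t * q1 t = lam" if "t \<in> ?I" for t
  proof -
    define x :: "real^2" where "x = axis 2 t"
    have x: "x \<in> cyl_coords ?I" "x $ 2 = t"
      using axis_coords[OF that] by (simp_all add: x_def axis_def)
    note h = hess_eq[OF x(1) uc q1 q2, unfolded x(2)] ricci_eq[OF x(1), unfolded x(2)]
      components[OF x(1), unfolded x(2)]
    show "- K t + q2 t - m * (q1 t)\<^sup>2 = lam"
      using field_eq[OF x(1), of 2 2] h by (simp add: K_def power2_eq_square)
    \<comment> \<open>The theta-theta equation; the quadratic term in du drops out, and division by
      the positive \<open>G t\<close> gives the claim.\<close>
    have "- G2 t / 2 + (G1 t)\<^sup>2 / (4 * G t) + G1 t * q1 t / 2 = lam * G t"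
      using field_eq[OF x(1), of 1 1] h by simp
    then show "- K t + f1 t / f t * q1 t = lam"
      using G(2)[OF that] by (simp add: K_def P[OF that] field_simps power2_eq_square)
  qed
  have "q1 t = 0" if "t \<in> ?I" for t
  proof (rule quasi_einstein_ode_derivative_zero[OF _ cont_q _ f_pos f1 q1 q2 _ that])
    show "q 0 = q 1" using ends by (simp add: q_def)
    show "q2 t - m * (q1 t)\<^sup>2 = f1 t / f t * q1 t" if "t \<in> ?I" for t
      using eq_tt[OF that] eq_\<theta>\<theta>[OF that] by linarith
  qed auto
  then have K: "K t = - lam" if "t \<in> ?I" for t
    using eq_\<theta>\<theta>[OF that] that by simp
  have lam_pos: "lam > 0"
    using assms(2) zero_le_power2[of pi] by linarith
  \<comment> \<open>Since \<open>K\<close> is now constant, f'' = -lam f. The bound on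
    \<open>lam\<close> makes the zero spacing \<open>pi / sqrt lam\<close> shorter than the unit
    interval.\<close>
  have "pi < sqrt lam"
    using assms(2) real_less_rsqrt by blast
  then have "pi / sqrt lam < 1 - 0" "sqrt lam > 0"
    using lam_pos by simp_all
  then show False
  proof (rule sturm_no_positive_solution[OF _ _ f_pos f1])
    show "(f1 has_real_derivative - (sqrt lam)\<^sup>2 * f t) (at t)" if "t \<in> ?I" for t
      using f2[OF that] K[OF that] lam_pos by simp
  qed
qed

end
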